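(* Let $\hat f_{k\star}(G,\tilde d_{max},\varepsilon)$ be any one-round LDP algorithm that computes (i.e. estimates) $f_{k\star}(G)$ satisfying $\varepsilon$-edge LDP. Then, for all $k,n,\tilde d_{max}\in\mathbb{N}$ and $\varepsilon\in\mathbb{R}_{\ge 0}$ such that $n$ is even, there exists a set of graphs $\mathcal{A}\subseteq\mathcal{G}$ on $n$ nodes such that the maximum degree of each $G\in\mathcal{A}$ is at most $\tilde d_{max}$, and $$\frac{1}{|\mathcal{A}|}\sum_{G\in\mathcal{A}}\mathbb{E}\big[(\hat f_{k\star}(G,\tilde d_{max},\varepsilon)-f_{k\star}(G))^2\big]\ \ge\ \Omega\left(\frac{e^{2\varepsilon}}{(e^{2\varepsilon}+1)^2}\,\tilde d_{max}^{\,2k-2}\,n\right).$$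
   Context: $\mathbb{N}=\{1,2,\dots\}$ and $\mathbb{R}_{\ge 0}$ is the set of non-negative reals. $\mathcal{G}$ is the set of undirected graphs $G$ on $n$ nodes (users) $v_1,\dots,v_n$; $\mathbf{a}_i\in\{0,1\}^n$ (the neighbor list of $v_i$) is the $i$-th row of the symmetric adjacency matrix of $G$. A $k$-star consists of a central node connected to $k$ other nodes, and $f_{k\star}(G)$ is the number of $k$-stars in $G$. The parameter $\tilde d_{max}$ plays the role of an upper bound on the maximum degree of the graph. $\varepsilon$-edge LDP: a randomized algorithm $\mathcal{R}_i$ of user $v_i$ with domain $\{0,1\}^n$ provides $\varepsilon$-edge LDP if for any two neighbor lists $\mathbf{a}_i,\mathbf{a}_i'\in\{0,1\}^n$ that differ in one bit and any $S\subseteq\mathrm{Range}(\mathcal{R}_i)$, $\Pr[\mathcal{R}_i(\mathbf{a}_i)\in S]\le e^{\varepsilon}\Pr[\mathcal{R}_i(\mathbf{a}_i')\in S]$. A one-round LDP algorithm satisfying $\varepsilon$-edge LDP is an estimator of the form $\hat f(G)=\tilde f(\mathcal{R}_1(\mathbf{a}_1),\dots,\mathcal{R}_n(\mathbf{a}_n))$, where $\mathcal{R}_1,\dots,\mathcal{R}_n$ are independently run randomized algorithms with domain $\{0,1\}^n$, each providing $\varepsilon$-edge LDP, and $\tilde f$ is a real-valued aggregate function of their outputs. Expectations are over the randomness of the algorithm. $\Omega(\cdot)$ is the usual asymptotic lower-bound notation; the source does not specify its constant or on which parameters it may depend.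
   Formalization: The bound is stated for k ≤ d̃_max ≤ n−1 rather than all k, n, d̃_max (it fails for d̃_max < k, and for k ≥ 2 as d̃_max grows with n fixed), and Ω is read as a positive constant depending only on k. *)

theory Defs
  imports "HOL-Probability.Probability"
begin

text \<open>
  A graph on \<open>n\<close> nodes is the set of edges of a simple undirected graph with node
  set \<open>{..<n}\<close>, an edge being a two-element set of nodes.
\<close>

definition graphs :: "nat \<Rightarrow> nat set set set" where
  "graphs n = Pow {e. e \<subseteq> {..<n} \<and> card e = 2}"

definition neighbours :: "nat set set \<Rightarrow> nat \<Rightarrow> nat set" where
  "neighbours G v = {u. {v, u} \<in> G}"

definition max_degree :: "nat \<Rightarrow> nat set set \<Rightarrow> nat" where
  "max_degree n G = Max ((\<lambda>v. card (neighbours G v)) ` {..<n})"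

text \<open>
  A star is given by its centre and its set of leaves. For \<open>k = 1\<close> an edge therefore
  counts twice, once for each choice of the centre, so that the number of stars is
  always the sum of \<open>deg v choose k\<close> over all nodes \<open>v\<close>.
\<close>

definition num_stars :: "nat \<Rightarrow> nat \<Rightarrow> nat set set \<Rightarrow> nat" where
  "num_stars k n G = card {(v, S). v < n \<and> S \<subseteq> neighbours G v \<and> card S = k}"

text \<open>
  The \<open>i\<close>-th row of the adjacency matrix. The diagonal entry is \<open>False\<close> for
  \<open>G \<in> graphs n\<close>, because \<open>{i, i}\<close> is a singleton.
\<close>

definition neighbour_list :: "nat \<Rightarrow> nat set set \<Rightarrow> nat \<Rightarrow> bool list" where
  "neighbour_list n G i = map (\<lambda>j. {i, j} \<in> G) [0..<n]"

definition differ_in_one_bit :: "bool list \<Rightarrow> bool list \<Rightarrow> bool" where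
  "differ_in_one_bit a b \<longleftrightarrow>
     length a = length b \<and> card {j. j < length a \<and> a ! j \<noteq> b ! j} = 1"

text \<open>
  A randomized algorithm with domain \<open>{0,1}^n\<close> and outputs in the measurable space
  \<open>M\<close> maps every bit list of length \<open>n\<close> to its output distribution on \<open>M\<close>.
\<close>

definition randomized_algorithm ::
    "nat \<Rightarrow> 'b measure \<Rightarrow> (bool list \<Rightarrow> 'b measure) \<Rightarrow> bool" where
  "randomized_algorithm n M R \<longleftrightarrow> (\<forall>a. length a = n \<longrightarrow> R a \<in> space (prob_algebra M))"

definition edge_LDP ::
    "real \<Rightarrow> nat \<Rightarrow> 'b measure \<Rightarrow> (bool list \<Rightarrow> 'b measure) \<Rightarrow> bool" where
  "edge_LDP \<epsilon> n M R \<longleftrightarrow>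
     (\<forall>a b. length a = n \<longrightarrow> length b = n \<longrightarrow> differ_in_one_bit a b \<longrightarrow>
        (\<forall>S\<in>sets M. measure (R a) S \<le> exp \<epsilon> * measure (R b) S))"

text \<open>
  User \<open>i\<close> runs \<open>R i\<close>, with outputs in \<open>M i\<close>; \<open>g\<close> aggregates the family of all outputs.
\<close>

definition one_round_LDP ::
    "real \<Rightarrow> nat \<Rightarrow> (nat \<Rightarrow> 'b measure) \<Rightarrow> (nat \<Rightarrow> bool list \<Rightarrow> 'b measure) \<Rightarrow>
     ((nat \<Rightarrow> 'b) \<Rightarrow> real) \<Rightarrow> bool" where
  "one_round_LDP \<epsilon> n M R g \<longleftrightarrow>
     (\<forall>i<n. randomized_algorithm n (M i) (R i) \<and> edge_LDP \<epsilon> n (M i) (R i)) \<and>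
     g \<in> borel_measurable (PiM {..<n} M)"

text \<open>The users' algorithms run independently, hence the product measure.\<close>

definition output_dist ::
    "nat \<Rightarrow> (nat \<Rightarrow> bool list \<Rightarrow> 'b measure) \<Rightarrow> nat set set \<Rightarrow> (nat \<Rightarrow> 'b) measure" where
  "output_dist n R G = PiM {..<n} (\<lambda>i. R i (neighbour_list n G i))"

text \<open>
  The expected squared error is taken in \<open>ennreal\<close>, since an estimator need not have
  a finite second moment; the Bochner integral would then be \<open>0\<close>.
\<close>

definition expected_sq_error ::
    "nat \<Rightarrow> (nat \<Rightarrow> bool list \<Rightarrow> 'b measure) \<Rightarrow> ((nat \<Rightarrow> 'b) \<Rightarrow> real) \<Rightarrow>
     (nat set set \<Rightarrow> real) \<Rightarrow> nat set set \<Rightarrow> ennreal" where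
  "expected_sq_error n R g f G = (\<integral>\<^sup>+ y. ennreal ((g y - f G)\<^sup>2) \<partial>output_dist n R G)"

end

theory Submission
  imports Defs "HOL-Number_Theory.Cong"
begin

text \<open>
  Take the first \<open>d\<close> colour classes of a one-factorization of the complete graph. The last
  \<open>d - 1\<close> of them form a regular graph \<open>G\<close>; the edges of the remaining perfect matching are
  added to \<open>G\<close> independently with probability \<open>1/2\<close>. Every added edge raises the number of
  \<open>k\<close>-stars by the same amount \<open>D = 2 (d - 1 choose k - 1)\<close>, so the estimator has to guess
  \<open>D\<close> times the number of added edges. The presence of a matching edge is visible only to
  its two end points, whose joint output has a density ratio in
  \<open>[exp (- 2 \<epsilon>), exp (2 \<epsilon>)]\<close>. Given the outputs, the \<open>n / 2\<close> edge indicators are hence still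
  independent, each with variance at least \<open>exp (2 \<epsilon>) / (exp (2 \<epsilon>) + 1)\<^sup>2\<close>.
\<close>

section \<open>Squared error against a sum of independent biased coins\<close>

lemma sum_Pow_insert:
  assumes "finite I" "v \<notin> I"
  shows "(\<Sum>B\<in>Pow (insert v I). f B) = (\<Sum>B\<in>Pow I. f B + f (insert v B))"
proof -
  have "(\<Sum>B\<in>Pow (insert v I). f B) = (\<Sum>B\<in>Pow I. f B) + (\<Sum>B\<in>insert v ` Pow I. f B)"
    unfolding Pow_insert by (rule sum.union_disjoint) (use assms in auto)
  also have "(\<Sum>B\<in>insert v ` Pow I. f B) = (\<Sum>B\<in>Pow I. f (insert v B))"
    by (subst sum.reindex) (use assms in \<open>auto intro!: inj_onI simp: o_def\<close>)
  finally show ?thesis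
    by (simp add: sum.distrib)
qed

text \<open>A coin with odds \<open>H\<close> has variance \<open>H / (1 + H)\<^sup>2\<close>. This
  is unchanged under passing to \<open>1 / H\<close> and falls as the odds move away from 1, so over
  \<open>[1 / E, E]\<close> it is smallest at the ends. The cross-multiplied difference factors as
  \<open>(E - H) * (H * E - 1)\<close>.\<close>

lemma bernoulli_variance_lower_bound:
  fixes H E :: real
  assumes "1 / E \<le> H" "H \<le> E" "0 < E"
  shows "E / (1 + E)\<^sup>2 \<le> H / (1 + H)\<^sup>2"
proof -
  have H: "0 < H" using assms(1,3) by (smt (verit) divide_pos_pos)
  have "1 \<le> H * E" using assms by (simp add: field_simps)
  then have "0 \<le> (E - H) * (H * E - 1)" using assms by simp
  then have "E * (1 + H)\<^sup>2 \<le> H * (1 + E)\<^sup>2"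
    by (simp add: algebra_simps power2_eq_square)
  then show ?thesis using H assms(3) by (simp add: divide_simps)
qed

text \<open>Divided by the product of the \<open>1 + H v\<close>, the weights are the law of a
  random set \<open>B\<close> that contains each \<open>v\<close> independently with odds
  \<open>H v\<close>. The claim is then the bias-variance decomposition of the guess
  \<open>x\<close>: \<open>m\<close> is the mean of \<open>D * card B\<close>, and the variances of
  the coins add up. It matters that \<open>m\<close> is chosen before \<open>x\<close>, since the
  induction uses the hypothesis at two guesses with the same \<open>m\<close>.\<close>

lemma weighted_sq_error_lower_bound:
  fixes H :: "'v \<Rightarrow> real"
  assumes "finite I" and H: "\<And>v. v \<in> I \<Longrightarrow> 1 / E \<le> H v \<and> H v \<le> E" and "0 < E"
  shows "\<exists>m. \<forall>x. (\<Prod>v\<in>I. 1 + H v) * ((x - m)\<^sup>2 + D\<^sup>2 * real (card I) * (E / (1 + E)\<^sup>2))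
     \<le> (\<Sum>B\<in>Pow I. (x - D * real (card B))\<^sup>2 * (\<Prod>v\<in>B. H v))"
  using assms(1) H
proof (induction I rule: finite_induct)
  case empty
  show ?case by (auto intro: exI[of _ 0])
next
  case (insert v I)
  let ?w = "E / (1 + E)\<^sup>2" and ?Z = "\<Prod>v\<in>I. 1 + H v"
  let ?s = "D\<^sup>2 * real (card I) * ?w"
  let ?S = "\<lambda>x. \<Sum>B\<in>Pow I. (x - D * real (card B))\<^sup>2 * (\<Prod>v\<in>B. H v)"
  obtain m where m: "\<And>x. ?Z * ((x - m)\<^sup>2 + ?s) \<le> ?S x"
    using insert by auto
  have pos: "0 < H u" if "u \<in> insert v I" for u
    using insert.prems[OF that] \<open>0 < E\<close> by (smt (verit) divide_pos_pos)
  \<comment> \<open>The probability that the new coin \<open>v\<close> comes up; the mean moves from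
    \<open>m\<close> to \<open>m + q * D\<close>.\<close>
  define q where "q = H v / (1 + H v)"
  have Hv: "0 < 1 + H v" "0 \<le> H v" using pos[of v] by auto
  have Z: "0 \<le> ?Z" using pos by (intro prod_nonneg) (smt (verit) insertI2)
  have w: "?w \<le> H v / (1 + H v)\<^sup>2"
    using bernoulli_variance_lower_bound insert.prems[of v] \<open>0 < E\<close> by auto
  show ?case
  proof (intro exI allI)
    fix x
    let ?t = "x - m"
    have Hq: "H v = q * (1 + H v)" using Hv by (simp add: q_def)
    \<comment> \<open>Bias-variance identity for the single coin \<open>v\<close>, whose outcomes
      leave the errors \<open>?t\<close> and \<open>?t - D\<close> with weights 1 and
      \<open>H v\<close>.\<close>
    have "(1 + H v) * ((x - (m + q * D))\<^sup>2 + D\<^sup>2 * (H v / (1 + H v)\<^sup>2)) = ?t\<^sup>2 + H v * (?t - D)\<^sup>2"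
    proof -
      have "H v / (1 + H v)\<^sup>2 = q * (1 - q)"
        using Hv by (simp add: q_def field_simps power2_eq_square)
      moreover have "(1 + H v) * ((x - (m + q * D))\<^sup>2 + D\<^sup>2 * (q * (1 - q))) =
        (1 + H v) * ?t\<^sup>2 + (q * (1 + H v)) * (D\<^sup>2 - 2 * D * ?t)"
        by (simp add: algebra_simps power2_eq_square)
      ultimately have "(1 + H v) * ((x - (m + q * D))\<^sup>2 + D\<^sup>2 * (H v / (1 + H v)\<^sup>2)) =
        (1 + H v) * ?t\<^sup>2 + H v * (D\<^sup>2 - 2 * D * ?t)"
        by (metis Hq)
      also have "\<dots> = ?t\<^sup>2 + H v * (?t - D)\<^sup>2"
        by (simp add: algebra_simps power2_eq_square)
      finally show ?thesis .
    qed
    then have "(1 + H v) * ((x - (m + q * D))\<^sup>2 + D\<^sup>2 * (H v / (1 + H v)\<^sup>2) + ?s)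
        = ?t\<^sup>2 + H v * (?t - D)\<^sup>2 + (1 + H v) * ?s"
      by (simp only: distrib_left)
    also have "?t - D = x - D - m" by simp
    also have "?t\<^sup>2 + H v * (x - D - m)\<^sup>2 + (1 + H v) * ?s =
        (?t\<^sup>2 + ?s) + H v * ((x - D - m)\<^sup>2 + ?s)"
      by (simp add: distrib_left distrib_right add_divide_distrib)
    finally have id: "(1 + H v) * ((x - (m + q * D))\<^sup>2 + D\<^sup>2 * (H v / (1 + H v)\<^sup>2) + ?s)
        = (?t\<^sup>2 + ?s) + H v * ((x - D - m)\<^sup>2 + ?s)" .
    have "(\<Prod>u\<in>insert v I. 1 + H u) *
        ((x - (m + q * D))\<^sup>2 + D\<^sup>2 * real (card (insert v I)) * ?w)
      = ?Z * ((1 + H v) * ((x - (m + q * D))\<^sup>2 + D\<^sup>2 * ?w + ?s))"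
      using insert.hyps by (simp add: algebra_simps add_divide_distrib)
    also have "\<dots> \<le> ?Z * ((1 + H v) * ((x - (m + q * D))\<^sup>2 + D\<^sup>2 * (H v / (1 + H v)\<^sup>2) + ?s))"
      using w Z Hv by (intro mult_left_mono add_mono order.refl) auto
    also have "\<dots> = ?Z * (?t\<^sup>2 + ?s) + H v * (?Z * ((x - D - m)\<^sup>2 + ?s))"
      unfolding id by (simp add: algebra_simps)
    \<comment> \<open>Sets without \<open>v\<close> use the hypothesis at \<open>x\<close>; sets
      with \<open>v\<close> contribute one further \<open>D\<close>, which shifts the guess to
      \<open>x - D\<close>.\<close>
    also have "\<dots> \<le> ?S x + H v * ?S (x - D)"
      by (intro add_mono mult_left_mono m Hv)
    also have "\<dots> = (\<Sum>B\<in>Pow (insert v I). (x - D * real (card B))\<^sup>2 * (\<Prod>v\<in>B. H v))"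
      unfolding sum_Pow_insert[OF insert.hyps] sum.distrib sum_distrib_left
    proof (intro arg_cong2[of _ _ _ _ "(+)"] refl sum.cong)
      fix B assume B: "B \<in> Pow I"
      then have "finite B" "v \<notin> B" using insert.hyps finite_subset by auto
      then show "H v * ((x - D - D * real (card B))\<^sup>2 * prod H B) =
          (x - D * real (card (insert v B)))\<^sup>2 * prod H (insert v B)"
        by (simp add: algebra_simps)
    qed
    finally show "(\<Prod>u\<in>insert v I. 1 + H u) *
        ((x - (m + q * D))\<^sup>2 + D\<^sup>2 * real (card (insert v I)) * ?w) \<le> \<dots>" .
  qed
qed

section \<open>Product densities and bounded likelihood ratios\<close>

text \<open>Both measures agree on boxes, where the integral of a product of one-variable functions
  factors, and boxes determine the product measure.\<close>

lemma PiM_density: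
  assumes "product_sigma_finite M" "finite I"
    and h: "\<And>i. i \<in> I \<Longrightarrow> h i \<in> borel_measurable (M i)"
    and dens: "\<And>i. i \<in> I \<Longrightarrow> sigma_finite_measure (density (M i) (h i))"
  shows "PiM I (\<lambda>i. density (M i) (h i)) = density (PiM I M) (\<lambda>y. \<Prod>i\<in>I. h i (y i))"
proof -
  interpret M: product_sigma_finite M by fact
  \<comment> \<open>Outside \<open>I\<close> the original \<open>M i\<close> is kept: the product
    locale wants sigma-finiteness at every index, but \<open>dens\<close> provides it for the
    densities only on \<open>I\<close>.\<close>
  define N where "N i = (if i \<in> I then density (M i) (h i) else M i)" for i
  interpret N: product_sigma_finite N
    using dens M.sigma_finite_measures by (intro product_sigma_finite.intro) (auto simp: N_def)
  have "density (PiM I M) (\<lambda>y. \<Prod>i\<in>I. h i (y i)) = PiM I N"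
  proof (rule N.PiM_eqI[OF \<open>finite I\<close>])
    show "sets (density (PiM I M) (\<lambda>y. \<Prod>i\<in>I. h i (y i))) = sets (PiM I N)"
      unfolding sets_density by (intro sets_PiM_cong) (auto simp: N_def)
  next
    fix A assume "\<And>i. i \<in> I \<Longrightarrow> A i \<in> sets (N i)"
    then have A: "\<And>i. i \<in> I \<Longrightarrow> A i \<in> sets (M i)" by (auto simp: N_def)
    have "emeasure (density (PiM I M) (\<lambda>y. \<Prod>i\<in>I. h i (y i))) (Pi\<^sub>E I A) =
        (\<integral>\<^sup>+y. (\<Prod>i\<in>I. h i (y i)) * indicator (Pi\<^sub>E I A) y \<partial>PiM I M)"
      using h A \<open>finite I\<close>
      by (intro emeasure_density borel_measurable_prod_ennreal
          measurable_compose[OF measurable_component_singleton] sets_PiM_I_finite) auto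
    also have "\<dots> = (\<integral>\<^sup>+y. (\<Prod>i\<in>I. h i (y i) * indicator (A i) (y i)) \<partial>PiM I M)"
    proof (intro nn_integral_cong)
      fix y assume "y \<in> space (PiM I M)"
      then have "(indicator (Pi\<^sub>E I A) y :: ennreal) = (\<Prod>i\<in>I. indicator (A i) (y i))"
        using \<open>finite I\<close>
        by (cases "\<forall>i\<in>I. y i \<in> A i") (auto simp: space_PiM PiE_iff indicator_def)
      then show "(\<Prod>i\<in>I. h i (y i)) * indicator (Pi\<^sub>E I A) y =
          (\<Prod>i\<in>I. h i (y i) * indicator (A i) (y i))"
        by (simp add: prod.distrib)
    qed
    also have "\<dots> = (\<Prod>i\<in>I. \<integral>\<^sup>+x. h i x * indicator (A i) x \<partial>M i)"
      using h A by (intro M.product_nn_integral_prod \<open>finite I\<close>) auto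
    also have "\<dots> = (\<Prod>i\<in>I. emeasure (N i) (A i))"
      using h A by (intro prod.cong refl) (simp add: emeasure_density N_def)
    finally show "emeasure (density (PiM I M) (\<lambda>y. \<Prod>i\<in>I. h i (y i))) (Pi\<^sub>E I A) = \<dots>" .
  qed
  moreover have "PiM I N = PiM I (\<lambda>i. density (M i) (h i))"
    by (intro PiM_cong) (auto simp: N_def)
  ultimately show ?thesis by simp
qed

text \<open>Testing \<open>le\<close> on the set where \<open>g < f\<close> suffices: if that set
  were not null, \<open>f\<close> would have the strictly larger integral there. Strictness needs
  the integral of \<open>g\<close> to be finite.\<close>

lemma AE_le_if_set_nn_integral_le:
  assumes f[measurable]: "f \<in> borel_measurable M" and g[measurable]: "g \<in> borel_measurable M"
    and fin: "(\<integral>\<^sup>+x. g x \<partial>M) \<noteq> \<infinity>"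
    and le: "\<And>S. S \<in> sets M \<Longrightarrow>
      (\<integral>\<^sup>+x. f x * indicator S x \<partial>M) \<le> (\<integral>\<^sup>+x. g x * indicator S x \<partial>M)"
  shows "AE x in M. f x \<le> g x"
proof -
  let ?S = "{x \<in> space M. g x < f x}"
  have S[measurable]: "?S \<in> sets M" by measurable
  have "(\<integral>\<^sup>+x. g x * indicator ?S x \<partial>M) \<le> (\<integral>\<^sup>+x. g x \<partial>M)"
    by (intro nn_integral_mono) (auto simp: indicator_def)
  then have fin_S: "(\<integral>\<^sup>+x. g x * indicator ?S x \<partial>M) \<noteq> \<infinity>"
    using fin by (auto simp: top_unique)
  have AE_ge: "AE x in M. g x * indicator ?S x \<le> f x * indicator ?S x"
    by (auto simp: indicator_def less_imp_le)
  have "AE x in M. f x * indicator ?S x \<le> g x * indicator ?S x"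
  proof (rule ccontr)
    assume "\<not> (AE x in M. f x * indicator ?S x \<le> g x * indicator ?S x)"
    from nn_integral_less[OF _ _ fin_S AE_ge this] le[OF S] show False
      by (simp add: not_less[symmetric])
  qed
  then show ?thesis
    using AE_space
    by eventually_elim (metis (mono_tags, lifting) indicator_simps(1) linorder_le_cases
        mem_Collect_eq mult.right_neutral not_less)
qed

text \<open>The bounds on events pass to the Radon-Nikodym density almost everywhere. Correcting it
  on a null set makes them hold at every point, so that products of such densities can later be
  estimated pointwise.\<close>

lemma bounded_density_exists:
  assumes "prob_space P" "prob_space Q" and sets: "sets Q = sets P" and "0 < c"
    and QP: "\<And>S. S \<in> sets P \<Longrightarrow> measure Q S \<le> c * measure P S"
    and PQ: "\<And>S. S \<in> sets P \<Longrightarrow> measure P S \<le> c * measure Q S"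
  shows "\<exists>h\<in>borel_measurable P. (\<forall>x. 1 / c \<le> h x \<and> h x \<le> c) \<and>
    Q = density P (\<lambda>x. ennreal (h x))"
proof -
  interpret P: prob_space P by fact
  interpret Q: prob_space Q by fact
  have QP': "emeasure Q S \<le> ennreal c * emeasure P S" if "S \<in> sets P" for S
    using QP[OF that] \<open>0 < c\<close>
    by (simp add: P.emeasure_eq_measure Q.emeasure_eq_measure ennreal_mult'[symmetric] ennreal_leI)
  have PQ': "emeasure P S \<le> ennreal c * emeasure Q S" if "S \<in> sets P" for S
    using PQ[OF that] \<open>0 < c\<close>
    by (simp add: P.emeasure_eq_measure Q.emeasure_eq_measure ennreal_mult'[symmetric] ennreal_leI)
  have "absolutely_continuous P Q"
    unfolding absolutely_continuous_def null_sets_def using QP' sets by fastforce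
  then obtain f where f[measurable]: "f \<in> borel_measurable P" and Q: "density P f = Q"
    using P.Radon_Nikodym sets by blast
  have Qf: "emeasure Q S = (\<integral>\<^sup>+x. f x * indicator S x \<partial>P)" if "S \<in> sets P" for S
    using that by (simp add: Q[symmetric] emeasure_density)
  have f1: "(\<integral>\<^sup>+x. f x \<partial>P) = 1"
    using Qf[OF sets.top] Q.emeasure_space_1 sets_eq_imp_space_eq[OF sets]
    by (simp cong: nn_integral_cong)
  have up: "AE x in P. f x \<le> ennreal c"
  proof (rule AE_le_if_set_nn_integral_le)
    show "(\<integral>\<^sup>+x. ennreal c \<partial>P) \<noteq> \<infinity>" by (simp add: P.emeasure_space_1)
    fix S assume "S \<in> sets P"
    then show "(\<integral>\<^sup>+x. f x * indicator S x \<partial>P) \<le> (\<integral>\<^sup>+x. ennreal c * indicator S x \<partial>P)"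
      using QP'[of S] by (simp add: Qf nn_integral_cmult_indicator)
  qed auto
  have low: "AE x in P. 1 \<le> ennreal c * f x"
  proof (rule AE_le_if_set_nn_integral_le)
    show "(\<integral>\<^sup>+x. ennreal c * f x \<partial>P) \<noteq> \<infinity>" by (simp add: nn_integral_cmult f1)
    fix S assume S: "S \<in> sets P"
    then show "(\<integral>\<^sup>+x. 1 * indicator S x \<partial>P) \<le> (\<integral>\<^sup>+x. ennreal c * f x * indicator S x \<partial>P)"
      using PQ'[of S] by (simp add: Qf nn_integral_cmult[symmetric] mult.assoc)
  qed auto
  \<comment> \<open>The default 1 lies in \<open>[1 / c, c]\<close> because
    \<open>1 \<le> c\<close>, which follows from \<open>QP\<close> on the whole space.\<close>
  define h where "h x = (if 1 / c \<le> enn2real (f x) \<and> enn2real (f x) \<le> c then enn2real (f x) else 1)" for x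
  have c1: "1 \<le> c" using QP[OF sets.top] P.prob_space Q.prob_space sets_eq_imp_space_eq[OF sets] by simp
  have [measurable]: "h \<in> borel_measurable P"
    unfolding h_def by measurable
  have "AE x in P. f x = ennreal (h x)"
    using up low
  proof eventually_elim
    case (elim x)
    obtain r where r: "0 \<le> r" "f x = ennreal r"
      using elim(1) by (cases "f x") (auto simp: top_unique)
    have "r \<le> c" using elim(1) r \<open>0 < c\<close> by simp
    moreover have "1 \<le> c * r"
      using elim(2) r \<open>0 < c\<close> by (simp add: ennreal_mult'[symmetric] flip: ennreal_1)
    ultimately show ?case
      using r \<open>0 < c\<close> by (simp add: h_def field_simps)
  qed
  then have "density P f = density P (\<lambda>x. ennreal (h x))"
    by (intro density_cong) auto
  moreover have "\<forall>x. 1 / c \<le> h x \<and> h x \<le> c"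
    using c1 by (auto simp: h_def)
  ultimately show ?thesis
    using Q by (intro bexI[of _ h]) auto
qed

section \<open>Bayes risk of estimating the number of hidden coins that are on\<close>

text \<open>\<open>B\<close> is the set of coins that are on, and user \<open>u\<close> sees only
  the coin \<open>r u\<close>. As \<open>m\<close> users see each coin, their joint output has a
  likelihood ratio in \<open>[1 / c ^ m, c ^ m]\<close>. For each fixed output \<open>y\<close> the
  sum over \<open>B\<close> is a posterior squared error, to which the bound for independent coins
  applies. The factor \<open>2 ^ card I\<close> appears because the right side is a sum over all
  \<open>B\<close>, not an average.\<close>

lemma average_sq_error_lower_bound:
  fixes P :: "'u \<Rightarrow> bool \<Rightarrow> 'b measure" and r :: "'u \<Rightarrow> 'v" and c K D :: real
  assumes "finite U" "finite I" "r ` U \<subseteq> I"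
    and fibre: "\<And>v. v \<in> I \<Longrightarrow> card {u \<in> U. r u = v} = m"
    and prob: "\<And>u b. u \<in> U \<Longrightarrow> prob_space (P u b)"
    and sets: "\<And>u b. u \<in> U \<Longrightarrow> sets (P u b) = sets (M u)"
    and LDP: "\<And>u b S. u \<in> U \<Longrightarrow> S \<in> sets (M u) \<Longrightarrow>
      measure (P u b) S \<le> c * measure (P u (\<not> b)) S"
    and "0 < c" and g: "g \<in> borel_measurable (PiM U M)"
  shows "ennreal (2 ^ card I * (D\<^sup>2 * real (card I) * (c ^ m / (1 + c ^ m)\<^sup>2)))
    \<le> (\<Sum>B\<in>Pow I. \<integral>\<^sup>+y. ennreal ((g y - (K + D * real (card B)))\<^sup>2)
          \<partial>PiM U (\<lambda>u. P u (r u \<in> B)))"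
proof -
  have "\<exists>h\<in>borel_measurable (P u False). (\<forall>x. 1 / c \<le> h x \<and> h x \<le> c) \<and>
      P u True = density (P u False) (\<lambda>x. ennreal (h x))" if "u \<in> U" for u
    using that prob sets LDP[of u _ True] LDP[of u _ False] \<open>0 < c\<close>
    by (intro bounded_density_exists) auto
  then obtain h where hm: "\<And>u. u \<in> U \<Longrightarrow> h u \<in> borel_measurable (P u False)"
    and hb: "\<And>u x. u \<in> U \<Longrightarrow> 1 / c \<le> h u x \<and> h u x \<le> c"
    and hd: "\<And>u. u \<in> U \<Longrightarrow> P u True = density (P u False) (\<lambda>x. ennreal (h u x))"
    by metis
  \<comment> \<open>The reference law, with all coins off. Indices outside \<open>U\<close> receive
    an arbitrary probability measure.\<close>
  define N where "N u = (if u \<in> U then P u False else return (count_space UNIV) undefined)" for u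
  have Nprob: "prob_space (N u)" for u
    using prob by (auto simp: N_def intro!: prob_space_return)
  interpret N: product_sigma_finite N
    using Nprob by (intro product_sigma_finite.intro prob_space_imp_sigma_finite)
  let ?\<mu> = "PiM U N"
  interpret mu: prob_space ?\<mu> by (intro prob_space_PiM Nprob)
  \<comment> \<open>The likelihood ratio of coin \<open>v\<close> being on against off, given the
    outputs of the users who see it.\<close>
  define H where "H v y = (\<Prod>u | u \<in> U \<and> r u = v. h u (y u))" for v y
  have h_pos: "0 < h u x" if "u \<in> U" for u x
    using hb[OF that, of x] \<open>0 < c\<close> by (smt (verit) divide_pos_pos)
  have H_bounds: "1 / c ^ m \<le> H v y \<and> H v y \<le> c ^ m" if "v \<in> I" for v y
  proof
    have "H v y \<le> (\<Prod>u | u \<in> U \<and> r u = v. c)"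
      unfolding H_def using hb h_pos by (intro prod_mono) (auto intro: less_imp_le)
    then show "H v y \<le> c ^ m" using fibre[OF that] by simp
    have "(\<Prod>u | u \<in> U \<and> r u = v. 1 / c) \<le> H v y"
      unfolding H_def using hb \<open>0 < c\<close> by (intro prod_mono) auto
    then show "1 / c ^ m \<le> H v y" using fibre[OF that] by (simp add: power_one_over)
  qed
  have H_nonneg: "0 \<le> H v y" for v y
    unfolding H_def by (intro prod_nonneg) (auto intro: less_imp_le h_pos)
  have hm'[measurable]: "(\<lambda>y. h u (y u)) \<in> borel_measurable ?\<mu>" if "u \<in> U" for u
    using hm[OF that] that by (intro measurable_compose[OF measurable_component_singleton]) (auto simp: N_def)
  have H_meas[measurable]: "H v \<in> borel_measurable ?\<mu>" for v
    unfolding H_def using hm' by (intro borel_measurable_prod) auto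
  have sets_mu: "sets ?\<mu> = sets (PiM U M)"
    using sets by (intro sets_PiM_cong) (auto simp: N_def)
  have g_meas[measurable]: "g \<in> borel_measurable ?\<mu>"
    using g measurable_cong_sets[OF sets_mu refl] by blast
  \<comment> \<open>Grouping the users by their coin turns the product of their densities into the
    product of the ratios of the coins in \<open>B\<close>.\<close>
  have dens: "PiM U (\<lambda>u. P u (r u \<in> B)) = density ?\<mu> (\<lambda>y. ennreal (\<Prod>v\<in>B. H v y))"
    if B: "B \<in> Pow I" for B
  proof -
    have finB: "finite B" using B \<open>finite I\<close> finite_subset by auto
    let ?f = "\<lambda>u x. if r u \<in> B then ennreal (h u x) else 1"
    have dP: "density (N u) (?f u) = P u (r u \<in> B)" if "u \<in> U" for u
      using that by (cases "r u \<in> B") (simp_all add: N_def hd density_1)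
    have "PiM U (\<lambda>u. P u (r u \<in> B)) = PiM U (\<lambda>u. density (N u) (?f u))"
      using dP by (intro PiM_cong) auto
    also have "\<dots> = density ?\<mu> (\<lambda>y. \<Prod>u\<in>U. ?f u (y u))"
      using \<open>finite U\<close> hm dP prob
      by (intro PiM_density N.product_sigma_finite_axioms)
        (auto simp: N_def prob_space_imp_sigma_finite)
    also have "(\<lambda>y. \<Prod>u\<in>U. ?f u (y u)) = (\<lambda>y. ennreal (\<Prod>v\<in>B. H v y))"
    proof
      fix y
      have "(\<Prod>u\<in>U. ?f u (y u)) = (\<Prod>u | u \<in> U \<and> r u \<in> B. ennreal (h u (y u)))"
        using \<open>finite U\<close> by (simp add: prod.inter_filter)
      also have "\<dots> = ennreal (\<Prod>u | u \<in> U \<and> r u \<in> B. h u (y u))"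
        by (intro prod_ennreal) (auto intro: less_imp_le h_pos)
      also have "(\<Prod>u | u \<in> U \<and> r u \<in> B. h u (y u)) =
          (\<Prod>v\<in>B. \<Prod>u | u \<in> {u \<in> U. r u \<in> B} \<and> r u = v. h u (y u))"
        using \<open>finite U\<close> finB by (intro prod.group[symmetric]) auto
      also have "\<dots> = (\<Prod>v\<in>B. H v y)"
        unfolding H_def by (intro prod.cong) auto
      finally show "(\<Prod>u\<in>U. ?f u (y u)) = ennreal (\<Prod>v\<in>B. H v y)" .
    qed
    finally show ?thesis .
  qed
  have total: "(\<integral>\<^sup>+y. ennreal (\<Prod>v\<in>B. H v y) \<partial>?\<mu>) = 1" if B: "B \<in> Pow I" for B
  proof -
    have "prob_space (PiM U (\<lambda>u. if u \<in> U then P u (r u \<in> B) else N u))"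
      using prob Nprob by (intro prob_space_PiM) auto
    also have "PiM U (\<lambda>u. if u \<in> U then P u (r u \<in> B) else N u) = PiM U (\<lambda>u. P u (r u \<in> B))"
      by (intro PiM_cong) auto
    also have "\<dots> = density ?\<mu> (\<lambda>y. ennreal (\<Prod>v\<in>B. H v y))"
      by (rule dens[OF B])
    finally show ?thesis
      using prob_space.emeasure_space_1 by (fastforce simp: emeasure_density cong: nn_integral_cong)
  qed
  define w where "w = D\<^sup>2 * real (card I) * (c ^ m / (1 + c ^ m)\<^sup>2)"
  have w: "0 \<le> w" unfolding w_def using \<open>0 < c\<close> by simp
  \<comment> \<open>The sum over subsets of the products of the \<open>H v y\<close> is the expanded
    product of the \<open>1 + H v y\<close>; the squared bias is then dropped.\<close>
  have pointwise: "w * (\<Sum>B\<in>Pow I. \<Prod>v\<in>B. H v y) \<le>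
      (\<Sum>B\<in>Pow I. (\<Prod>v\<in>B. H v y) * (g y - (K + D * real (card B)))\<^sup>2)" for y
  proof -
    obtain x0 where x0: "\<And>x. (\<Prod>v\<in>I. 1 + H v y) * ((x - x0)\<^sup>2 + w)
       \<le> (\<Sum>B\<in>Pow I. (x - D * real (card B))\<^sup>2 * (\<Prod>v\<in>B. H v y))"
      using weighted_sq_error_lower_bound[OF \<open>finite I\<close>, of "c ^ m" "\<lambda>v. H v y" D]
        H_bounds \<open>0 < c\<close> unfolding w_def by auto
    have "w * (\<Sum>B\<in>Pow I. \<Prod>v\<in>B. H v y) = (\<Prod>v\<in>I. 1 + H v y) * w"
      using prod_add[OF \<open>finite I\<close>, of "\<lambda>v. H v y" "\<lambda>_. 1"] by (simp add: add.commute)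
    also have "\<dots> \<le> (\<Prod>v\<in>I. 1 + H v y) * ((g y - K - x0)\<^sup>2 + w)"
      using H_nonneg by (intro mult_left_mono prod_nonneg) (auto intro: add_nonneg_nonneg)
    also have "\<dots> \<le> (\<Sum>B\<in>Pow I. (g y - K - D * real (card B))\<^sup>2 * (\<Prod>v\<in>B. H v y))"
      by (rule x0)
    finally show ?thesis by (simp add: mult.commute diff_diff_eq)
  qed
  have PH: "0 \<le> (\<Prod>v\<in>B. H v y)" for B y
    by (intro prod_nonneg) (auto simp: H_nonneg)
  have PHm: "(\<lambda>y. \<Prod>v\<in>B. H v y) \<in> borel_measurable ?\<mu>" for B
    by (intro borel_measurable_prod) auto
  have "ennreal (2 ^ card I * w) = ennreal w * (\<Sum>B\<in>Pow I. 1)"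
    using w \<open>finite I\<close> by (simp add: card_Pow ennreal_mult mult.commute flip: ennreal_power)
  also have "\<dots> = ennreal w * (\<Sum>B\<in>Pow I. \<integral>\<^sup>+y. ennreal (\<Prod>v\<in>B. H v y) \<partial>?\<mu>)"
    using total by simp
  also have "\<dots> = (\<integral>\<^sup>+y. ennreal w * (\<Sum>B\<in>Pow I. ennreal (\<Prod>v\<in>B. H v y)) \<partial>?\<mu>)"
    using PHm by (simp add: nn_integral_cmult nn_integral_sum)
  also have "\<dots> \<le> (\<integral>\<^sup>+y. (\<Sum>B\<in>Pow I. ennreal (\<Prod>v\<in>B. H v y) *
      ennreal ((g y - (K + D * real (card B)))\<^sup>2)) \<partial>?\<mu>)"
    using pointwise w PH
    by (intro nn_integral_mono)
      (simp add: sum_ennreal sum_nonneg ennreal_mult'[symmetric] ennreal_leI)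
  also have "\<dots> = (\<Sum>B\<in>Pow I. \<integral>\<^sup>+y. ennreal (\<Prod>v\<in>B. H v y) *
      ennreal ((g y - (K + D * real (card B)))\<^sup>2) \<partial>?\<mu>)"
    using PHm by (intro nn_integral_sum) measurable
  also have "\<dots> = (\<Sum>B\<in>Pow I. \<integral>\<^sup>+y. ennreal ((g y - (K + D * real (card B)))\<^sup>2)
      \<partial>PiM U (\<lambda>u. P u (r u \<in> B)))"
    using PHm by (intro sum.cong refl) (simp add: dens nn_integral_density)
  finally show ?thesis unfolding w_def .
qed

section \<open>Binomial estimate and star counts from degrees\<close>

text \<open>Follows from \<open>(a / b) ^ b \<le> a choose b\<close>; the factor 2 in the
  denominator pays for replacing \<open>d - 1\<close> by \<open>d\<close>, as
  \<open>d \<le> 2 * (d - 1)\<close> for \<open>2 \<le> d\<close>.\<close>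

lemma binomial_ge_pow:
  assumes "1 \<le> k" "k \<le> d"
  shows "(real d / real (2 * k)) ^ (k - 1) \<le> real ((d - 1) choose (k - 1))"
proof (cases "k = 1")
  case False
  with assms have k: "2 \<le> k" "2 \<le> d" by auto
  have "(real d / real (2 * k)) ^ (k - 1) \<le> (real (d - 1) / real (k - 1)) ^ (k - 1)"
  proof (intro power_mono)
    have "real d / real (2 * k) \<le> real (2 * (d - 1)) / real (2 * (k - 1))"
      using k by (intro frac_le) auto
    also have "\<dots> = real (d - 1) / real (k - 1)"
      unfolding of_nat_mult by (rule mult_divide_mult_cancel_left) simp
    finally show "real d / real (2 * k) \<le> real (d - 1) / real (k - 1)" .
  qed auto
  also have "\<dots> \<le> real ((d - 1) choose (k - 1))"
    using assms by (intro binomial_ge_n_over_k_pow_k) auto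
  finally show ?thesis .
qed simp

lemma num_stars_eq_sum:
  assumes "G \<in> graphs n"
  shows "num_stars k n G = (\<Sum>v<n. card (neighbours G v) choose k)"
proof -
  have fin: "finite (neighbours G v)" for v
  proof (rule finite_subset)
    show "neighbours G v \<subseteq> {..<n}" using assms by (auto simp: neighbours_def graphs_def)
  qed simp
  have "{(v, S). v < n \<and> S \<subseteq> neighbours G v \<and> card S = k}
      = (SIGMA v:{..<n}. {S. S \<subseteq> neighbours G v \<and> card S = k})"
    by auto
  then have "num_stars k n G = (\<Sum>v<n. card {S. S \<subseteq> neighbours G v \<and> card S = k})"
    using fin by (simp add: num_stars_def card_SigmaI)
  then show ?thesis using fin by (simp add: n_subsets)
qed

section \<open>A regular graph and a perfect matching disjoint from it\<close>

text \<open>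
  The round-robin edge colouring of the complete graph on an even number of nodes:
  node \<open>n - 1\<close> plays the role of \<open>\<infinity>\<close>, and every colour class is a perfect matching.
\<close>

definition round_robin :: "nat \<Rightarrow> nat \<Rightarrow> nat \<Rightarrow> nat" where
  "round_robin n u v = (if u = n - 1 then 2 * v else if v = n - 1 then 2 * u else u + v) mod (n - 1)"

lemma round_robin_commute: "u \<noteq> v \<Longrightarrow> round_robin n u v = round_robin n v u"
  by (simp add: round_robin_def add.commute)

text \<open>At the node \<open>n - 1\<close> the colour is a doubling, which is injective modulo the
  odd number \<open>n - 1\<close>. At any other \<open>v\<close> it is a translation; the residue of
  \<open>2 * v\<close>, missed because \<open>x = v\<close> is excluded, is the colour of the edge
  to \<open>n - 1\<close>. Surjectivity follows by counting.\<close>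

lemma bij_betw_round_robin:
  assumes "even n" "v < n"
  shows "bij_betw (round_robin n v) ({..<n} - {v}) {..<n - 1}"
proof -
  have n: "2 \<le> n" "odd (n - 1)" using assms by presburger+
  have mod_eq: "x = y" if "[x = y] (mod (n - 1))" "x < n - 1" "y < n - 1" for x y
    using that by (simp add: cong_def)
  have "inj_on (round_robin n v) ({..<n} - {v})"
  proof (rule inj_onI)
    fix x y
    assume xy: "x \<in> {..<n} - {v}" "y \<in> {..<n} - {v}" "round_robin n v x = round_robin n v y"
    show "x = y"
    proof (cases "v = n - 1")
      case True
      then have "[2 * x = 2 * y] (mod (n - 1))" "x < n - 1" "y < n - 1"
        using xy by (auto simp: round_robin_def cong_def)
      moreover have "coprime 2 (n - 1)" using n by simp
      ultimately show ?thesis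
        using mod_eq cong_mult_lcancel_nat by blast
    next
      case False
      then have "v < n - 1" using assms by simp
      moreover have "[v + x = v + y] (mod (n - 1))" if "x < n - 1" "y < n - 1"
        using that False xy by (simp add: round_robin_def cong_def)
      moreover have "[v + v = v + y] (mod (n - 1))" if "x = n - 1" "y < n - 1"
        using that False xy by (simp add: round_robin_def cong_def mult_2)
      moreover have "[v + x = v + v] (mod (n - 1))" if "y = n - 1" "x < n - 1"
        using that False xy by (simp add: round_robin_def cong_def mult_2)
      moreover have "x < n - 1 \<or> x = n - 1" "y < n - 1 \<or> y = n - 1" using xy by auto
      ultimately show ?thesis
        using mod_eq xy by (metis DiffD2 cong_add_lcancel_nat singletonI)
    qed
  qed
  moreover have "round_robin n v ` ({..<n} - {v}) = {..<n - 1}"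
  proof (rule card_subset_eq)
    show "round_robin n v ` ({..<n} - {v}) \<subseteq> {..<n - 1}"
      using n by (auto simp: round_robin_def)
    show "card (round_robin n v ` ({..<n} - {v})) = card {..<n - 1}"
      using calculation assms by (simp add: card_image)
  qed simp
  ultimately show ?thesis by (simp add: bij_betw_def)
qed

text \<open>Every node meets every colour exactly once. Colour 0 gives the matching
  \<open>p\<close>, colours 1 to \<open>d - 1\<close> give \<open>G\<close>, and
  \<open>d < n\<close> ensures that these colours exist.\<close>

lemma regular_graph_avoiding_matching_exists:
  assumes "even n" "1 \<le> d" "d < n"
  shows "\<exists>G p. G \<in> graphs n \<and> (\<forall>v<n. p v < n \<and> p v \<noteq> v \<and> p (p v) = v \<and>
    p v \<notin> neighbours G v \<and> card (neighbours G v) = d - 1)"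
proof -
  note bij = bij_betw_round_robin[OF \<open>even n\<close>]
  define p where "p v = inv_into ({..<n} - {v}) (round_robin n v) 0" for v
  define G where "G = {{u, v} | u v. u < n \<and> v < n \<and> u \<noteq> v \<and> round_robin n u v \<in> {1..<d}}"
  have p: "p v < n" "p v \<noteq> v" "round_robin n v (p v) = 0" if "v < n" for v
  proof -
    have 0: "0 \<in> round_robin n v ` ({..<n} - {v})"
      using bij[OF that] assms by (auto simp: bij_betw_def)
    from inv_into_into[OF 0] show "p v < n" "p v \<noteq> v" by (auto simp: p_def)
    from f_inv_into_f[OF 0] show "round_robin n v (p v) = 0" by (simp add: p_def)
  qed
  have p_unique: "u = p v" if "v < n" "u < n" "u \<noteq> v" "round_robin n v u = 0" for u v
    using bij[OF \<open>v < n\<close>] that p[OF \<open>v < n\<close>]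
    by (auto simp: bij_betw_def inj_on_def)
  have pp: "p (p v) = v" if "v < n" for v
    using p_unique[of "p v" v] p[OF that] round_robin_commute[of v "p v" n] that by simp
  have nb: "neighbours G v = {u \<in> {..<n} - {v}. round_robin n v u \<in> {1..<d}}" if "v < n" for v
    unfolding neighbours_def G_def using that
    by (auto simp: doubleton_eq_iff round_robin_commute)
  have "card (neighbours G v) = d - 1" if "v < n" for v
  proof -
    have "round_robin n v ` neighbours G v = round_robin n v ` ({..<n} - {v}) \<inter> {1..<d}"
      unfolding nb[OF that] by blast
    also have "\<dots> = {1..<d}"
      using bij_betw_imp_surj_on[OF bij[OF that]] \<open>d < n\<close> by auto
    finally have "bij_betw (round_robin n v) (neighbours G v) {1..<d}"
      by (intro bij_betw_subset[OF bij[OF that]]) (auto simp: nb[OF that])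
    then show ?thesis by (simp add: bij_betw_same_card)
  qed
  moreover have "p v \<notin> neighbours G v" if "v < n" for v
    using p[OF that] by (simp add: nb[OF that])
  moreover have "G \<in> graphs n" by (auto simp: graphs_def G_def)
  ultimately show ?thesis
    using p pp by (intro exI[of _ G] exI[of _ p] conjI allI impI)
qed

section \<open>Adding matching edges to a regular graph\<close>

text \<open>A perfect matching is encoded as the fixed-point-free involution that sends a node to
  its partner.\<close>

locale node_matching =
  fixes n :: nat and p :: "nat \<Rightarrow> nat"
  assumes p_less: "v < n \<Longrightarrow> p v < n"
    and p_neq: "v < n \<Longrightarrow> p v \<noteq> v"
    and p_p: "v < n \<Longrightarrow> p (p v) = v"
begin

text \<open>Matching edges are named by their smaller end points, so subsets of \<open>lower\<close>
  are the possible choices of edges to add.\<close>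

definition lower :: "nat set" where
  "lower = {v. v < n \<and> v < p v}"

definition rep :: "nat \<Rightarrow> nat" where
  "rep v = min v (p v)"

definition add_edges :: "nat set set \<Rightarrow> nat set \<Rightarrow> nat set set" where
  "add_edges G B = G \<union> (\<lambda>v. {v, p v}) ` B"

lemma finite_lower [simp]: "finite lower"
  by (rule finite_subset[of _ "{..<n}"]) (auto simp: lower_def)

lemma rep_in_lower: "v < n \<Longrightarrow> rep v \<in> lower"
  using p_less p_neq p_p by (fastforce simp: rep_def lower_def min_def)

lemma rep_fibre: "v \<in> lower \<Longrightarrow> {u \<in> {..<n}. rep u = v} = {v, p v}"
  using p_less p_neq p_p by (auto simp: rep_def lower_def min_def split: if_splits)

lemma card_rep_fibre: "v \<in> lower \<Longrightarrow> card {u \<in> {..<n}. rep u = v} = 2"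
  unfolding rep_fibre using p_neq[of v] by (auto simp: lower_def)

text \<open>Each fibre of \<open>rep\<close> consists of the two end points of one matching
  edge.\<close>

lemma sum_by_rep:
  fixes f :: "nat \<Rightarrow> 'a::comm_semiring_1"
  shows "(\<Sum>v<n. f (rep v)) = 2 * (\<Sum>v\<in>lower. f v)"
proof -
  have "(\<Sum>v<n. f (rep v)) = (\<Sum>v\<in>lower. \<Sum>u\<in>{u \<in> {..<n}. rep u = v}. f (rep u))"
    using rep_in_lower by (intro sum.group[symmetric]) auto
  also have "\<dots> = (\<Sum>v\<in>lower. \<Sum>u\<in>{u \<in> {..<n}. rep u = v}. f v)"
    by (intro sum.cong) auto
  also have "\<dots> = 2 * (\<Sum>v\<in>lower. f v)"
    by (simp add: card_rep_fibre[simplified] sum_distrib_left)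
  finally show ?thesis .
qed

lemma card_lower: "2 * card lower = n"
  using sum_by_rep[of "\<lambda>_. 1 :: nat"] by simp

lemma edge_in_matching_iff:
  assumes "B \<subseteq> lower" "v < n"
  shows "{v, u} \<in> (\<lambda>v. {v, p v}) ` B \<longleftrightarrow> u = p v \<and> rep v \<in> B"
proof
  assume "{v, u} \<in> (\<lambda>v. {v, p v}) ` B"
  then obtain b where b: "b \<in> B" "{v, u} = {b, p b}" by blast
  then have "b < n" "b < p b" using assms(1) by (auto simp: lower_def)
  then show "u = p v \<and> rep v \<in> B"
    using b p_p[of b] by (auto simp: doubleton_eq_iff rep_def min_def)
next
  assume u: "u = p v \<and> rep v \<in> B"
  then have "{v, u} = {rep v, p (rep v)}"
    using p_p[OF assms(2)] by (auto simp: rep_def min_def)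
  then show "{v, u} \<in> (\<lambda>v. {v, p v}) ` B" using u by blast
qed

lemma edge_in_add_edges_iff:
  assumes "B \<subseteq> lower" "v < n"
  shows "{v, u} \<in> add_edges G B \<longleftrightarrow> {v, u} \<in> G \<or> u = p v \<and> rep v \<in> B"
  unfolding add_edges_def using edge_in_matching_iff[OF assms] by blast

lemma add_edges_in_graphs:
  assumes "G \<in> graphs n" "B \<subseteq> lower"
  shows "add_edges G B \<in> graphs n"
proof -
  have "{v, p v} \<subseteq> {..<n} \<and> card {v, p v} = 2" if "v \<in> B" for v
    using that assms(2) p_less[of v] p_neq[of v] by (auto simp: lower_def)
  then show ?thesis using assms(1) by (auto simp: graphs_def add_edges_def)
qed

lemma neighbour_list_add_edges:
  assumes "B \<subseteq> lower" "v < n"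
  shows "neighbour_list n (add_edges G B) v =
    map (\<lambda>u. {v, u} \<in> G \<or> u = p v \<and> rep v \<in> B) [0..<n]"
  using edge_in_add_edges_iff[OF assms] by (simp add: neighbour_list_def)

context
  fixes G d
  assumes G: "G \<in> graphs n"
    and p_notin: "\<And>v. v < n \<Longrightarrow> p v \<notin> neighbours G v"
    and regular: "\<And>v. v < n \<Longrightarrow> card (neighbours G v) = d"
begin

lemma card_neighbours_add_edges:
  assumes "B \<subseteq> lower" "v < n"
  shows "card (neighbours (add_edges G B) v) = (if rep v \<in> B then Suc d else d)"
proof -
  have "neighbours (add_edges G B) v = neighbours G v \<union> (if rep v \<in> B then {p v} else {})"
    unfolding neighbours_def using edge_in_add_edges_iff[OF assms] by auto
  moreover have "finite (neighbours G v)"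
    by (rule finite_subset[of _ "{..<n}"]) (use G in \<open>auto simp: neighbours_def graphs_def\<close>)
  ultimately show ?thesis
    using p_notin[OF \<open>v < n\<close>] regular[OF \<open>v < n\<close>] by simp
qed

lemma max_degree_add_edges:
  assumes "B \<subseteq> lower" "0 < n"
  shows "max_degree n (add_edges G B) \<le> Suc d"
  unfolding max_degree_def
  using assms card_neighbours_add_edges[OF assms(1)] by (subst Max_le_iff) auto

text \<open>By Pascal's rule a degree that grows from \<open>d\<close> to \<open>Suc d\<close> gains
  \<open>d choose (k - 1)\<close> stars at that centre, and each added edge does this at both of its
  ends. The first summand is the count for \<open>G\<close> itself, with
  \<open>2 * card lower\<close> nodes.\<close>

lemma num_stars_add_edges:
  assumes "B \<subseteq> lower" "1 \<le> k"
  shows "num_stars k n (add_edges G B) =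
    2 * card lower * (d choose k) + 2 * (d choose (k - 1)) * card B"
proof -
  have "num_stars k n (add_edges G B) =
      (\<Sum>v<n. (d choose k) + (if rep v \<in> B then d choose (k - 1) else 0))"
    unfolding num_stars_eq_sum[OF add_edges_in_graphs[OF G assms(1)]]
    using assms card_neighbours_add_edges[OF assms(1)]
    by (intro sum.cong refl) (auto simp: gr0_conv_Suc Suc_le_eq)
  also have "\<dots> = 2 * (\<Sum>v\<in>lower. (d choose k) + (if v \<in> B then d choose (k - 1) else 0))"
    using sum_by_rep[of "\<lambda>v. (d choose k) + (if v \<in> B then d choose (k - 1) else 0)"] by simp
  also have "\<dots> = 2 * (card lower * (d choose k) + (\<Sum>v\<in>lower. if v \<in> B then d choose (k - 1) else 0))"
    by (simp add: sum.distrib)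
  also have "(\<Sum>v\<in>lower. if v \<in> B then d choose (k - 1) else 0) = (d choose (k - 1)) * card B"
    using assms(1) by (simp add: sum.If_cases Int_absorb1 mult.commute)
  finally show ?thesis by (simp add: algebra_simps)
qed

end

text \<open>\<open>G\<close> contains no matching edge, so \<open>B\<close> can be read off from the
  enlarged graph. Hence the family has \<open>2 ^ card lower\<close> members.\<close>

lemma inj_on_add_edges:
  assumes "\<And>v. v < n \<Longrightarrow> p v \<notin> neighbours G v"
  shows "inj_on (add_edges G) (Pow lower)"
proof (rule inj_onI)
  have mem: "v \<in> B \<longleftrightarrow> {v, p v} \<in> add_edges G B" if "v \<in> lower" "B \<in> Pow lower" for v B
    using that assms[of v] edge_in_add_edges_iff[of B v "p v" G]
    by (auto simp: lower_def neighbours_def rep_def min_def)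
  fix B C assume "B \<in> Pow lower" "C \<in> Pow lower" "add_edges G B = add_edges G C"
  then show "B = C" using mem by blast
qed

end

section \<open>The lower bound for one-round edge-LDP star counting\<close>

text \<open>The constant depends on \<open>k\<close> only. The range \<open>k \<le> d\<close> allows
  the binomial estimate; for smaller \<open>d\<close> no admissible graph has a
  \<open>k\<close>-star and the zero estimator makes no error. The condition \<open>d < n\<close>
  provides the \<open>d\<close> colour classes.\<close>

theorem corollary1:
  fixes k :: nat
  assumes "1 \<le> k"
  shows "\<exists>c::real. c > 0 \<and>
    (\<forall>(n::nat) (d::nat) (\<epsilon>::real)
      (M :: nat \<Rightarrow> 'b measure) (R :: nat \<Rightarrow> bool list \<Rightarrow> 'b measure) (g :: (nat \<Rightarrow> 'b) \<Rightarrow> real).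
      even n \<longrightarrow> 1 \<le> n \<longrightarrow> k \<le> d \<longrightarrow> d < n \<longrightarrow> 0 \<le> \<epsilon> \<longrightarrow> one_round_LDP \<epsilon> n M R g \<longrightarrow>
      (\<exists>A. A \<subseteq> graphs n \<and> A \<noteq> {} \<and> (\<forall>G\<in>A. max_degree n G \<le> d) \<and>
        (\<Sum>G\<in>A. expected_sq_error n R g (\<lambda>G. real (num_stars k n G)) G) / of_nat (card A)
          \<ge> ennreal (c * (exp (2 * \<epsilon>) / (exp (2 * \<epsilon>) + 1)\<^sup>2
                     * real d ^ (2 * k - 2) * real n))))"
proof (intro exI[of _ "2 / real (2 * k) ^ (2 * k - 2)"] conjI allI impI)
  show "2 / real (2 * k) ^ (2 * k - 2) > 0" using assms by simp
next
  fix n d :: nat and \<epsilon> :: real and M :: "nat \<Rightarrow> 'b measure"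
    and R :: "nat \<Rightarrow> bool list \<Rightarrow> 'b measure" and g :: "(nat \<Rightarrow> 'b) \<Rightarrow> real"
  assume n: "even n" "1 \<le> n" and d: "k \<le> d" "d < n" and "0 \<le> \<epsilon>"
    and ldp: "one_round_LDP \<epsilon> n M R g"
  obtain G p where G: "G \<in> graphs n"
    and p: "\<And>v. v < n \<Longrightarrow> p v < n" "\<And>v. v < n \<Longrightarrow> p v \<noteq> v" "\<And>v. v < n \<Longrightarrow> p (p v) = v"
    and nb: "\<And>v. v < n \<Longrightarrow> p v \<notin> neighbours G v"
      "\<And>v. v < n \<Longrightarrow> card (neighbours G v) = d - 1"
    using regular_graph_avoiding_matching_exists[of n d] n d assms by auto
  interpret node_matching n p
    using p by unfold_locales
  \<comment> \<open>The output law of user \<open>u\<close> when the matching edge at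
    \<open>u\<close> is present or absent, according to \<open>b\<close>.\<close>
  define P where "P u b = R u (map (\<lambda>w. {u, w} \<in> G \<or> w = p u \<and> b) [0..<n])" for u b
  define K where "K = real (2 * card lower * ((d - 1) choose k))"
  define D where "D = real (2 * ((d - 1) choose (k - 1)))"
  \<comment> \<open>The average error bound with \<open>c = exp \<epsilon>\<close> and
    \<open>m = 2\<close>, each matching edge being seen by its two end points. \<open>K\<close> is
    the star count of \<open>G\<close>, and \<open>D\<close> the gain per added edge.\<close>
  define X where "X = D\<^sup>2 * real (card lower) * (exp \<epsilon> ^ 2 / (1 + exp \<epsilon> ^ 2)\<^sup>2)"
  let ?A = "add_edges G ` Pow lower"
  let ?err = "expected_sq_error n R g (\<lambda>G. real (num_stars k n G))"
  have alg: "R u a \<in> space (prob_algebra (M u))" if "u < n" "length a = n" for u a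
    using ldp that by (auto simp: one_round_LDP_def randomized_algorithm_def)
  have "ennreal (2 ^ card lower * X)
      \<le> (\<Sum>B\<in>Pow lower. \<integral>\<^sup>+y. ennreal ((g y - (K + D * real (card B)))\<^sup>2)
          \<partial>PiM {..<n} (\<lambda>u. P u (rep u \<in> B)))"
    unfolding X_def
  proof (rule average_sq_error_lower_bound[where M = M])
    show "rep ` {..<n} \<subseteq> lower" using rep_in_lower by auto
    show "prob_space (P u b)" "sets (P u b) = sets (M u)" if "u \<in> {..<n}" for u b
      using alg[of u] that by (auto simp: P_def space_prob_algebra)
    show "g \<in> borel_measurable (PiM {..<n} M)"
      using ldp by (simp add: one_round_LDP_def)
    fix u b S assume u: "u \<in> {..<n}" and S: "S \<in> sets (M u)"
    let ?row = "\<lambda>b. map (\<lambda>w. {u, w} \<in> G \<or> w = p u \<and> b) [0..<n]"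
    \<comment> \<open>Since \<open>G\<close> lacks the matching edge at \<open>u\<close>, the two
      rows differ exactly at position \<open>p u\<close>, as the privacy condition requires.\<close>
    have "{u, p u} \<notin> G" using nb(1) u by (auto simp: neighbours_def)
    then have "j < n \<and> ?row b ! j \<noteq> ?row (\<not> b) ! j \<longleftrightarrow> j = p u" for j
      using p(1)[of u] u by (cases "j < n"; cases "j = p u") simp_all
    then have "differ_in_one_bit (?row b) (?row (\<not> b))"
      by (simp add: differ_in_one_bit_def cong: conj_cong)
    then show "measure (P u b) S \<le> exp \<epsilon> * measure (P u (\<not> b)) S"
      using ldp u S by (simp add: one_round_LDP_def edge_LDP_def P_def)
  qed (auto simp: card_rep_fibre[simplified])
  also have "\<dots> = (\<Sum>B\<in>Pow lower. ?err (add_edges G B))"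
  proof (intro sum.cong refl)
    fix B assume "B \<in> Pow lower"
    then have B: "B \<subseteq> lower" by simp
    have "output_dist n R (add_edges G B) = PiM {..<n} (\<lambda>u. P u (rep u \<in> B))"
      unfolding output_dist_def P_def
      by (intro PiM_cong) (simp_all add: neighbour_list_add_edges[OF B])
    moreover have "real (num_stars k n (add_edges G B)) = K + D * real (card B)"
      using num_stars_add_edges[OF G nb B assms] by (simp add: K_def D_def)
    ultimately show "(\<integral>\<^sup>+y. ennreal ((g y - (K + D * real (card B)))\<^sup>2)
        \<partial>PiM {..<n} (\<lambda>u. P u (rep u \<in> B))) = ?err (add_edges G B)"
      by (simp add: expected_sq_error_def)
  qed
  also have "\<dots> = (\<Sum>G\<in>?A. ?err G)"
    by (subst sum.reindex[OF inj_on_add_edges[OF nb(1)]]) simp_all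
  finally have "ennreal (2 ^ card lower * X) / of_nat (card ?A) \<le> (\<Sum>G\<in>?A. ?err G) / of_nat (card ?A)"
    by (rule divide_right_mono_ennreal)
  moreover have "card ?A = 2 ^ card lower"
    by (subst card_image[OF inj_on_add_edges[OF nb(1)]]) (simp_all add: card_Pow)
  moreover have "0 \<le> X" "2 ^ card lower * X / real (2 ^ card lower) = X" by (simp_all add: X_def)
  ultimately have avg: "ennreal X \<le> (\<Sum>G\<in>?A. ?err G) / of_nat (card ?A)"
    by (simp add: ennreal_of_nat_eq_real_of_nat divide_ennreal del: of_nat_power)
  \<comment> \<open>The constant arises as 4 from the square of the 2 in \<open>D\<close>, times 1/2
    from the \<open>n / 2\<close> matching edges, over the power of \<open>2 * k\<close> from the
    binomial estimate.\<close>
  have "2 / real (2 * k) ^ (2 * k - 2) * (exp (2 * \<epsilon>) / (exp (2 * \<epsilon>) + 1)\<^sup>2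
      * real d ^ (2 * k - 2) * real n) \<le> X"
  proof -
    let ?w = "exp (2 * \<epsilon>) / (exp (2 * \<epsilon>) + 1)\<^sup>2"
    have "2 * k - 2 = (k - 1) * 2" by simp
    then have "(real d / real (2 * k)) ^ (2 * k - 2) = ((real d / real (2 * k)) ^ (k - 1))\<^sup>2"
      by (simp only: power_mult)
    also have "\<dots> \<le> (real ((d - 1) choose (k - 1)))\<^sup>2"
      using binomial_ge_pow[OF assms d(1)] by (intro power_mono) auto
    finally have "4 * (real d / real (2 * k)) ^ (2 * k - 2) \<le> D\<^sup>2"
      by (simp add: D_def power_mult_distrib)
    then have "4 * (real d / real (2 * k)) ^ (2 * k - 2) * (real n / 2 * ?w) \<le> D\<^sup>2 * (real n / 2 * ?w)"
      by (intro mult_right_mono) auto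
    moreover have half: "real (card lower) = real n / 2"
      using card_lower by (metis nonzero_mult_div_cancel_left of_nat_mult of_nat_numeral zero_neq_numeral)
    have "D\<^sup>2 * (real n / 2 * ?w) = X"
      unfolding X_def half exp_double by (simp add: add.commute)
    moreover have "4 * (real d / real (2 * k)) ^ (2 * k - 2) * (real n / 2 * ?w) =
        2 / real (2 * k) ^ (2 * k - 2) * (?w * real d ^ (2 * k - 2) * real n)"
      unfolding power_divide by (simp add: mult.assoc mult.left_commute mult.commute)
    ultimately show ?thesis by simp
  qed
  then have "ennreal (2 / real (2 * k) ^ (2 * k - 2) * (exp (2 * \<epsilon>) / (exp (2 * \<epsilon>) + 1)\<^sup>2
      * real d ^ (2 * k - 2) * real n)) \<le> (\<Sum>G\<in>?A. ?err G) / of_nat (card ?A)"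
    using avg ennreal_leI order_trans by blast
  moreover have "?A \<subseteq> graphs n" using add_edges_in_graphs[OF G] by auto
  moreover have "max_degree n (add_edges G B) \<le> d" if "B \<subseteq> lower" for B
    using max_degree_add_edges[OF G nb that] n d assms by simp
  ultimately show "\<exists>A. A \<subseteq> graphs n \<and> A \<noteq> {} \<and> (\<forall>G\<in>A. max_degree n G \<le> d) \<and>
      ennreal (2 / real (2 * k) ^ (2 * k - 2) * (exp (2 * \<epsilon>) / (exp (2 * \<epsilon>) + 1)\<^sup>2
        * real d ^ (2 * k - 2) * real n)) \<le> (\<Sum>G\<in>A. ?err G) / of_nat (card A)"
    by (intro exI[of _ ?A]) auto
qed

end
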